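(* Let $\tau$ be an anti-symmetric bilinear form on $V$ with $\operatorname{Rank}\tau\ge 4$. Then $G_{R^{\Lambda}_{\tau}}=G^{\pm}_{\tau}$.
   Context: $V$ is a finite-dimensional real vector space. For an anti-symmetric bilinear form $\tau$ on $V$, define $$R^{\Lambda}_{\tau}(x,y,z,w)=\tau(x,w)\tau(y,z)-\tau(x,z)\tau(y,w)-2\tau(x,y)\tau(z,w).$$ For a linear map $A:V\to V$, $A*$ denotes precomposition with $A$: $(A*\tau)(x,y)=\tau(Ax,Ay)$ and $(A*R)(x,y,z,w)=R(Ax,Ay,Az,Aw)$. Define the structure groups $$G_{R^{\Lambda}_{\tau}}=\{A\in GL(V) : A*R^{\Lambda}_{\tau}=R^{\Lambda}_{\tau}\},\qquad G^{\pm}_{\tau}=\{A\in GL(V): A*\tau=\tau \text{ or } A*\tau=-\tau\}.$$ *)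

theory Defs
  imports "HOL-Analysis.Analysis" "HOL-Library.Function_Algebras"
begin

type_synonym 'v form2 = "'v \<Rightarrow> 'v \<Rightarrow> real"
type_synonym 'v form4 = "'v \<Rightarrow> 'v \<Rightarrow> 'v \<Rightarrow> 'v \<Rightarrow> real"

definition antisymmetric_bilinear :: "('v::real_vector) form2 \<Rightarrow> bool" where
  "antisymmetric_bilinear \<tau> \<longleftrightarrow> bilinear \<tau> \<and> (\<forall>x y. \<tau> x y = - \<tau> y x)"

definition fun_scale :: "real \<Rightarrow> ('v \<Rightarrow> real) \<Rightarrow> 'v \<Rightarrow> real" where
  "fun_scale c f = (\<lambda>x. c * f x)"

text \<open>
  Type classes do not make \<open>'v \<Rightarrow> real\<close> a real vector space, hence the explicit scaling.
\<close>

lemma vector_space_fun_scale: "vector_space (fun_scale :: real \<Rightarrow> ('v \<Rightarrow> real) \<Rightarrow> _)"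
  by unfold_locales (auto simp: fun_scale_def plus_fun_def algebra_simps)

text \<open>
  The rank of a bilinear form is the rank of the linear map \<open>x \<mapsto> \<tau>(x, \<cdot>)\<close> from the space
  to its dual; partial application makes \<open>\<tau>\<close> itself that map, with values in the functions
  \<open>'v \<Rightarrow> real\<close>, of which the dual is a subspace.
\<close>

definition form_rank :: "('v::real_vector) form2 \<Rightarrow> nat" where
  "form_rank \<tau> = vector_space.dim fun_scale (range \<tau>)"

definition R_Lambda :: "('v::real_vector) form2 \<Rightarrow> 'v form4" where
  "R_Lambda \<tau> x y z w = \<tau> x w * \<tau> y z - \<tau> x z * \<tau> y w - 2 * \<tau> x y * \<tau> z w"

definition precompose2 :: "('v \<Rightarrow> 'v) \<Rightarrow> 'v form2 \<Rightarrow> 'v form2" where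
  "precompose2 A \<tau> x y = \<tau> (A x) (A y)"

definition precompose4 :: "('v \<Rightarrow> 'v) \<Rightarrow> 'v form4 \<Rightarrow> 'v form4" where
  "precompose4 A R x y z w = R (A x) (A y) (A z) (A w)"

definition general_linear :: "(('v::real_vector) \<Rightarrow> 'v) set" where
  "general_linear = {A. linear A \<and> bij A}"

definition structure_group :: "('v::real_vector) form4 \<Rightarrow> ('v \<Rightarrow> 'v) set" where
  "structure_group R = {A \<in> general_linear. precompose4 A R = R}"

definition G_pm :: "('v::real_vector) form2 \<Rightarrow> ('v \<Rightarrow> 'v) set" where
  "G_pm \<tau> = {A \<in> general_linear. precompose2 A \<tau> = \<tau> \<or> precompose2 A \<tau> = - \<tau>}"

end

theory Submission
  imports Defs
begin

text \<open>
  The sectional-curvature-like values \<open>R(x,y,y,x)\<close> of \<open>R_Lambda \<tau>\<close> are \<open>3 \<tau>(x,y)\<^sup>2\<close>, so the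
  tensor determines the values of \<open>\<tau>\<close> up to a sign that a priori varies with \<open>(x,y)\<close>.
  The sign cannot vary: a group is never the union of two proper subgroups. This is used twice,
  for fixed \<open>x\<close> to make the sign independent of \<open>y\<close>, and then for the maps
  \<open>x \<mapsto> (\<tau> \<mp> \<sigma>)(x, \<cdot>)\<close> to make it independent of \<open>x\<close>. Hence \<open>R_Lambda \<tau> = R_Lambda \<sigma>\<close>
  exactly when \<open>\<sigma> = \<tau>\<close> or \<open>\<sigma> = - \<tau>\<close> (the converse because \<open>R_Lambda\<close> is quadratic), and
  since \<open>R_Lambda\<close> commutes with precomposition, taking \<open>\<sigma> = A*\<tau>\<close> compares the two groups.
\<close>

lemma additive_zero_cover:
  fixes f :: "'a::ab_group_add \<Rightarrow> 'b::ab_group_add" and g :: "'a \<Rightarrow> 'c::ab_group_add"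
  assumes "Modules.additive f" "Modules.additive g" and cover: "\<And>x. f x = 0 \<or> g x = 0"
  shows "(\<forall>x. f x = 0) \<or> (\<forall>x. g x = 0)"
proof (rule ccontr)
  assume "\<not> ?thesis"
  then obtain a b where "f a \<noteq> 0" "g b \<noteq> 0" by blast
  moreover from this have "g a = 0" "f b = 0" using cover by blast+
  \<comment> \<open>Now neither map vanishes at \<open>a + b\<close>.\<close>
  ultimately show False
    using cover[of "a + b"] Modules.additive.add[OF assms(1)] Modules.additive.add[OF assms(2)] by simp
qed

text \<open>
  Equality of squares says \<open>(\<tau> - \<sigma>)(x,y) = 0\<close> or \<open>(\<tau> + \<sigma>)(x,y) = 0\<close> at each pair; the covering
  argument is applied first to the maps in \<open>y\<close> and then, with values in the group of functions,
  to the maps in \<open>x\<close>.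
\<close>

lemma bilinear_eq_or_minus_if_squares_eq:
  fixes \<tau> \<sigma> :: "('v::real_vector) form2"
  assumes "bilinear \<tau>" "bilinear \<sigma>" and squares: "\<And>x y. (\<sigma> x y)\<^sup>2 = (\<tau> x y)\<^sup>2"
  shows "\<sigma> = \<tau> \<or> \<sigma> = - \<tau>"
proof -
  note add = assms(1,2)[THEN bilinear_ladd] assms(1,2)[THEN bilinear_radd]
  have "\<sigma> x - \<tau> x = 0 \<or> \<sigma> x + \<tau> x = 0" for x
  proof -
    have "(\<forall>y. \<sigma> x y - \<tau> x y = 0) \<or> (\<forall>y. \<sigma> x y + \<tau> x y = 0)"
    proof (rule additive_zero_cover)
      show "\<sigma> x y - \<tau> x y = 0 \<or> \<sigma> x y + \<tau> x y = 0" for y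
        using squares[of x y] by (auto simp: power2_eq_iff)
    qed (auto intro!: Modules.additive.intro simp: add)
    then show ?thesis by (auto simp: fun_eq_iff)
  qed
  then have "(\<forall>x. \<sigma> x - \<tau> x = 0) \<or> (\<forall>x. \<sigma> x + \<tau> x = 0)"
    by (intro additive_zero_cover) (auto intro!: Modules.additive.intro simp: add fun_eq_iff)
  then show ?thesis
    by (auto simp: fun_eq_iff eq_neg_iff_add_eq_0)
qed

lemma R_Lambda_diagonal:
  assumes "antisymmetric_bilinear \<tau>"
  shows "R_Lambda \<tau> x y y x = 3 * (\<tau> x y)\<^sup>2"
proof -
  have anti: "\<tau> u v = - \<tau> v u" for u v
    using assms unfolding antisymmetric_bilinear_def by blast
  have "\<tau> x x = 0" using anti[of x x] by simp
  then show ?thesis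
    using anti[of y x] by (simp add: R_Lambda_def power2_eq_square)
qed

theorem R_Lambda_eq_iff:
  assumes "antisymmetric_bilinear \<tau>" "antisymmetric_bilinear \<sigma>"
  shows "R_Lambda \<sigma> = R_Lambda \<tau> \<longleftrightarrow> \<sigma> = \<tau> \<or> \<sigma> = - \<tau>"
proof
  assume "R_Lambda \<sigma> = R_Lambda \<tau>"
  then have "(\<sigma> x y)\<^sup>2 = (\<tau> x y)\<^sup>2" for x y
    using assms[THEN R_Lambda_diagonal, of x y] by simp
  then show "\<sigma> = \<tau> \<or> \<sigma> = - \<tau>"
    using assms unfolding antisymmetric_bilinear_def
    by (intro bilinear_eq_or_minus_if_squares_eq) blast+
qed (auto simp: R_Lambda_def fun_eq_iff)

lemma antisymmetric_bilinear_precompose2: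
  assumes "linear A" "antisymmetric_bilinear \<tau>"
  shows "antisymmetric_bilinear (precompose2 A \<tau>)"
proof -
  have b: "bilinear \<tau>" and anti: "\<And>x y. \<tau> x y = - \<tau> y x"
    using assms(2) unfolding antisymmetric_bilinear_def by blast+
  have "bilinear (precompose2 A \<tau>)"
    unfolding bilinear_def
    by (auto intro!: linearI simp: precompose2_def linear_add[OF assms(1)] linear_scale[OF assms(1)]
        bilinear_ladd[OF b] bilinear_radd[OF b] bilinear_lmul[OF b] bilinear_rmul[OF b])
  then show ?thesis
    unfolding antisymmetric_bilinear_def precompose2_def using anti by blast
qed

lemma precompose4_R_Lambda: "precompose4 A (R_Lambda \<tau>) = R_Lambda (precompose2 A \<tau>)"
  by (simp add: fun_eq_iff precompose4_def precompose2_def R_Lambda_def)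

theorem theorem3p2:
  fixes \<tau> :: "'v::real_vector \<Rightarrow> 'v \<Rightarrow> real"
  assumes "\<exists>B. finite_dimensional_vector_space ((*\<^sub>R) :: real \<Rightarrow> 'v \<Rightarrow> 'v) B"
    and "antisymmetric_bilinear \<tau>"
    and "form_rank \<tau> \<ge> 4"
  shows "structure_group (R_Lambda \<tau>) = G_pm \<tau>"
proof -
  have "precompose4 A (R_Lambda \<tau>) = R_Lambda \<tau> \<longleftrightarrow>
      precompose2 A \<tau> = \<tau> \<or> precompose2 A \<tau> = - \<tau>" if "A \<in> general_linear" for A
    using that R_Lambda_eq_iff[OF assms(2) antisymmetric_bilinear_precompose2[OF _ assms(2)]]
    by (simp add: general_linear_def precompose4_R_Lambda)
  then show ?thesis
    by (auto simp: structure_group_def G_pm_def)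
qed

end
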